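(* Let $X$ and $\Lambda$ be (nonempty) compact metric spaces, let $w:\Lambda\times X\to X$ be a weakly hyperbolic iterated function system, let $p$ be a Borel probability measure on $\Lambda$, and let $\mathbb P=p^{\mathbb N}$. Then the unique measure-theoretical attractor $\nu$ of $w$ (with respect to $p$) is ergodic: for every continuous function $f:X\to\mathbb R$, every $x\in X$ and $\mathbb P$-almost every $\sigma\in\Omega$, $$\lim_{n\to\infty}\frac1n\sum_{j=0}^{n}f\big(w_{\sigma_j}\circ\cdots\circ w_{\sigma_1}(x)\big)=\int_X f\,d\nu .$$
   Context: An iterated function system (IFS) is a continuous map $w:\Lambda\times X\to X$; put $w_\lambda(x):=w(\lambda,x)$ and $w_{\lambda_1\dots\lambda_n}:=w_{\lambda_1}\circ\cdots\circ w_{\lambda_n}$. $\Omega:=\Lambda^{\mathbb N}$ is the space of infinite words $\sigma=(\sigma_1,\sigma_2,\dots)$, with the product topology, and $\mathbb P=p^{\mathbb N}$ is the product measure on $\Omega$. With $X$ compact, $w$ is weakly hyperbolic if for every $\sigma\in\Omega$, $\lim_{n\to\infty}\mathrm{Diam}(w_{\sigma_1\dots\sigma_n}(X))=0$. $\mathcal M(X)$ is the set of Borel probability measures on the compact space $X$, with the Hutchinson metric $H(\nu,\mu)=\sup\{|\int f\,d\nu-\int f\,d\mu|: f:X\to\mathbb R,\ |f(x)-f(y)|\le d(x,y)\ \forall x,y\}$. The transfer operator is $T_p(\mu)(B)=\int_\Lambda\mu(w_\lambda^{-1}(B))\,dp(\lambda)$ for Borel $B$. The measure-theoretical attractor of $w$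 is the measure $\nu\in\mathcal M(X)$ such that $T_p^n(\mu)\to\nu$ in the Hutchinson metric for all $\mu\in\mathcal M(X)$; for a weakly hyperbolic IFS on compact $X$ it exists and is the unique fixed point of $T_p$. Convention: for $j=0$, $w_{\sigma_j}\circ\cdots\circ w_{\sigma_1}(x)=x$. *)

theory Defs
  imports "HOL-Probability.Probability"
begin

(* Infinite words are functions on nat counted from 0, so the letter sigma_k of the
   one-based notation is \<sigma> (k - 1).  The metric spaces X and Lambda are the types 'x and 'l. *)

(* word_map w \<sigma> n = w_{sigma_1} o ... o w_{sigma_n} *)
primrec word_map :: "('l \<Rightarrow> 'x \<Rightarrow> 'x) \<Rightarrow> (nat \<Rightarrow> 'l) \<Rightarrow> nat \<Rightarrow> 'x \<Rightarrow> 'x" where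
  "word_map w \<sigma> 0 = id"
| "word_map w \<sigma> (Suc n) = word_map w \<sigma> n \<circ> w (\<sigma> n)"

(* random_orbit w \<sigma> j x = (w_{sigma_j} o ... o w_{sigma_1}) x, the reverse order of composition *)
primrec random_orbit :: "('l \<Rightarrow> 'x \<Rightarrow> 'x) \<Rightarrow> (nat \<Rightarrow> 'l) \<Rightarrow> nat \<Rightarrow> 'x \<Rightarrow> 'x" where
  "random_orbit w \<sigma> 0 x = x"
| "random_orbit w \<sigma> (Suc j) x = w (\<sigma> j) (random_orbit w \<sigma> j x)"

definition weakly_hyperbolic :: "('l \<Rightarrow> 'x::metric_space \<Rightarrow> 'x) \<Rightarrow> bool" where
  "weakly_hyperbolic w \<longleftrightarrow> (\<forall>\<sigma>. (\<lambda>n. diameter (word_map w \<sigma> n ` UNIV)) \<longlonglongrightarrow> 0)"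

definition borel_prob_measures :: "'a::topological_space measure set" where
  "borel_prob_measures = {\<mu>. prob_space \<mu> \<and> sets \<mu> = sets borel}"

(* The supremum is over a bounded set of reals when the measures are Borel probability
   measures on a compact space. *)
definition hutchinson_dist :: "'x::metric_space measure \<Rightarrow> 'x measure \<Rightarrow> real" where
  "hutchinson_dist \<nu> \<mu> =
     (SUP f \<in> {f :: 'x \<Rightarrow> real. \<forall>x y. \<bar>f x - f y\<bar> \<le> dist x y}.
        \<bar>(\<integral>x. f x \<partial>\<nu>) - (\<integral>x. f x \<partial>\<mu>)\<bar>)"

(* measure_of yields the null measure unless the set function is countably additive.  It is so
   when w is continuous on compact metric spaces: then \<lambda>l. emeasure \<mu> (w l -` B) is Borel measurable. *)
definition transfer_op ::
    "('l \<Rightarrow> 'x::topological_space \<Rightarrow> 'x) \<Rightarrow> 'l measure \<Rightarrow> 'x measure \<Rightarrow> 'x measure" where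
  "transfer_op w p \<mu> =
     measure_of UNIV (sets borel) (\<lambda>B. \<integral>\<^sup>+l. emeasure \<mu> (w l -` B) \<partial>p)"

definition is_measure_attractor ::
    "('l \<Rightarrow> 'x::metric_space \<Rightarrow> 'x) \<Rightarrow> 'l measure \<Rightarrow> 'x measure \<Rightarrow> bool" where
  "is_measure_attractor w p \<nu> \<longleftrightarrow>
     \<nu> \<in> borel_prob_measures \<and>
     (\<forall>\<mu> \<in> borel_prob_measures.
        (\<lambda>n. hutchinson_dist ((transfer_op w p ^^ n) \<mu>) \<nu>) \<longlonglongrightarrow> 0)"

end

theory Submission
  imports Defs "HOL-Library.Discrete_Functions"
begin

text \<open>
  Write \<open>X\<^sub>j\<close> for the random orbit of a point \<open>x\<close> and \<open>(U f)(x) = \<integral> f (w l x) dp(l)\<close> for the transition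
  operator, the dual of the transfer operator.

  By compactness of the space of words, the diameters of the images
  \<open>w\<^bsub>\<sigma>1\<dots>\<sigma>n\<^esub>(X)\<close> tend to \<open>0\<close> uniformly in \<open>\<sigma>\<close> (\<open>uniform_contraction\<close>). Hence these nested
  sets shrink to one point, the address of \<open>\<sigma>\<close>, and the law \<open>\<nu>\<close> of the address of a random word is the
  attractor: \<open>(U\<^sup>n f)(x)\<close> is the mean of \<open>f (w\<^bsub>\<sigma>1\<dots>\<sigma>n\<^esub>(x))\<close>, which differs from \<open>\<integral> f d\<nu>\<close>
  by at most the oscillation of \<open>f\<close> on the sets \<open>w\<^bsub>\<sigma>1\<dots>\<sigma>n\<^esub>(X)\<close> (\<open>trans_op_funpow_close\<close>). For
  1-Lipschitz \<open>f\<close> this bound does not depend on \<open>f\<close>, which gives convergence in the Hutchinson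
  metric; for an arbitrary continuous \<open>f\<close> it still gives \<open>U\<^sup>n f \<longlongrightarrow> \<integral> f d\<nu>\<close> uniformly on \<open>X\<close>.
  The attractor is unique because the Lipschitz functions separate Borel probability measures.

  The ergodic averages are treated as in Breiman's law of large numbers for Markov chains. For each
  bounded \<open>g\<close> the variables \<open>g X\<^bsub>j+1\<^esub> - (U g) X\<^sub>j\<close> are bounded martingale differences, hence
  orthogonal, so their averages tend to \<open>0\<close> almost surely (\<open>orbit_increment_averages\<close>). Applied
  to \<open>g = f, U f, \<dots>, U\<^bsup>K-1\<^esup> f\<close> and summed, this says that the averages of \<open>f X\<^sub>j\<close> and of
  \<open>(U\<^sup>K f) X\<^sub>j\<close> have the same limiting behaviour; the latter function is uniformly close to the
  constant \<open>\<integral> f d\<nu>\<close> when \<open>K\<close> is large.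
\<close>

section \<open>Averages of real sequences\<close>

text \<open>
  Between two consecutive squares \<open>m\<^sup>2 \<le> n < (m + 1)\<^sup>2\<close> there are at most \<open>2 m\<close> further terms, whose
  contribution to the average is of order \<open>1 / m\<close>. For orthogonal variables the second moments
  of the averages are summable along the squares, so that the almost sure limit is first found there.
\<close>

lemma square_averages_imp_averages:
  fixes d :: "nat \<Rightarrow> real"
  assumes bound: "\<And>j. \<bar>d j\<bar> \<le> C"
    and sq: "(\<lambda>m. (\<Sum>j<m\<^sup>2. d j) / (real m)\<^sup>2) \<longlonglongrightarrow> 0"
  shows "(\<lambda>n. (\<Sum>j<n. d j) / real n) \<longlonglongrightarrow> 0"
proof -
  have C: "0 \<le> C" using bound[of 0] by linarith
  have lim: "filterlim floor_sqrt at_top at_top"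
    unfolding filterlim_at_top
  proof
    fix Z :: nat
    show "\<forall>\<^sub>F n in at_top. Z \<le> floor_sqrt n"
      unfolding eventually_at_top_linorder by (rule exI[of _ "Z\<^sup>2"]) (simp add: le_floor_sqrt_iff)
  qed
  let ?b = "\<lambda>m. \<bar>(\<Sum>j<m\<^sup>2. d j) / (real m)\<^sup>2\<bar> + 2 * C / real m"
  have "(\<lambda>m. 2 * C / real m) \<longlonglongrightarrow> 0" by (rule lim_const_over_n)
  with tendsto_rabs_zero[OF sq] have "?b \<longlonglongrightarrow> 0"
    by (rule tendsto_add_zero)
  then have b: "(\<lambda>n. ?b (floor_sqrt n)) \<longlonglongrightarrow> 0"
    by (rule filterlim_compose[OF _ lim])
  show ?thesis
  proof (rule Lim_null_comparison[OF _ b])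
    show "\<forall>\<^sub>F n in sequentially. norm ((\<Sum>j<n. d j) / real n) \<le> ?b (floor_sqrt n)"
      using eventually_gt_at_top[of 0]
    proof eventually_elim
      case (elim n)
      define m where "m = floor_sqrt n"
      have m: "m\<^sup>2 \<le> n" "n < (Suc m)\<^sup>2" "0 < m"
        using elim Suc_floor_sqrt_power2_gt[of n] by (auto simp: m_def)
      then have gap: "n - m\<^sup>2 \<le> 2 * m" by (simp add: power2_eq_square)
      have "{..<n} = {..<m\<^sup>2} \<union> {m\<^sup>2..<n}" using m(1) by auto
      then have "(\<Sum>j<n. d j) = (\<Sum>j<m\<^sup>2. d j) + (\<Sum>j=m\<^sup>2..<n. d j)"
        by (simp add: sum.union_disjoint ivl_disj_int)
      moreover have "\<bar>\<Sum>j=m\<^sup>2..<n. d j\<bar> \<le> (\<Sum>j=m\<^sup>2..<n. C)"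
        by (rule order_trans[OF sum_abs]) (rule sum_mono, rule bound)
      moreover have "(\<Sum>j=m\<^sup>2..<n. C) \<le> real (2 * m) * C"
        using gap C by (simp only: sum_constant card_atLeastLessThan) (intro mult_right_mono, auto)
      ultimately have *: "\<bar>\<Sum>j<n. d j\<bar> \<le> \<bar>\<Sum>j<m\<^sup>2. d j\<bar> + 2 * real m * C"
        by simp
      have "\<bar>\<Sum>j<n. d j\<bar> / real n \<le> \<bar>\<Sum>j<n. d j\<bar> / (real m)\<^sup>2"
        using m elim by (intro divide_left_mono) (auto simp flip: of_nat_power)
      also have "\<dots> \<le> (\<bar>\<Sum>j<m\<^sup>2. d j\<bar> + 2 * real m * C) / (real m)\<^sup>2"
        using * by (intro divide_right_mono) auto
      also have "\<dots> = ?b m"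
        using m(3) by (simp add: add_divide_distrib power2_eq_square)
      finally show ?case by (simp add: m_def)
    qed
  qed
qed

text \<open>
  In the application \<open>a k j\<close> is \<open>(U\<^sup>k f) X\<^sub>j\<close>. Shifting \<open>j\<close> by one does not affect limits of averages of
  bounded sequences, so by \<open>step\<close> consecutive rows have asymptotically equal averages, and
  by \<open>unif\<close> some row is uniformly close to \<open>c\<close>.
\<close>

lemma telescoping_averages_limit:
  fixes a :: "nat \<Rightarrow> nat \<Rightarrow> real"
  assumes bound: "\<And>k j. \<bar>a k j\<bar> \<le> B"
    and step: "\<And>k. (\<lambda>n. (\<Sum>j<n. a k (Suc j) - a (Suc k) j) / real n) \<longlonglongrightarrow> 0"
    and unif: "\<And>e. 0 < e \<Longrightarrow> \<exists>K. \<forall>j. \<bar>a K j - c\<bar> \<le> e"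
  shows "(\<lambda>n. (\<Sum>j=0..n. a 0 j) / real n) \<longlonglongrightarrow> c"
proof -
  have null: "(\<lambda>n. u n / real n) \<longlonglongrightarrow> 0" if "\<And>n. \<bar>u n\<bar> \<le> D" for u :: "nat \<Rightarrow> real" and D
  proof (rule Lim_null_comparison[OF _ lim_const_over_n[of D]])
    show "\<forall>\<^sub>F n in sequentially. norm (u n / real n) \<le> D / real n"
      using that by (intro always_eventually allI) (simp add: divide_right_mono)
  qed
  have descent: "(\<lambda>n. (\<Sum>j<n. a k j - a (Suc k) j) / real n) \<longlonglongrightarrow> 0" for k
  proof -
    have "\<bar>a k n - a k 0\<bar> \<le> 2 * B" for n
      using bound[of k n] bound[of k 0] by linarith
    from tendsto_diff[OF step[of k] null[OF this]]
    have "(\<lambda>n. (\<Sum>j<n. a k (Suc j) - a (Suc k) j) / real n - (a k n - a k 0) / real n) \<longlonglongrightarrow> 0"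
      by simp
    moreover have "(\<Sum>j<n. a k j - a (Suc k) j)
        = (\<Sum>j<n. a k (Suc j) - a (Suc k) j) - (a k n - a k 0)" for n
      using sum_lessThan_telescope[of "a k" n] by (simp add: sum_subtractf)
    ultimately show ?thesis by (simp add: diff_divide_distrib)
  qed
  have iter: "(\<lambda>n. (\<Sum>j<n. a 0 j - a K j) / real n) \<longlonglongrightarrow> 0" for K
  proof (induction K)
    case (Suc K)
    from tendsto_add[OF Suc descent[of K]] show ?case
      by (simp add: sum_subtractf diff_divide_distrib)
  qed simp
  have "(\<lambda>n. (\<Sum>j<n. a 0 j - c) / real n) \<longlonglongrightarrow> 0"
  proof (rule LIMSEQ_I)
    fix r :: real assume r: "0 < r"
    obtain K where K: "\<And>j. \<bar>a K j - c\<bar> \<le> r / 3" using unif[of "r / 3"] r by auto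
    obtain N where N: "\<And>n. N \<le> n \<Longrightarrow> \<bar>(\<Sum>j<n. a 0 j - a K j) / real n\<bar> < r / 3"
      using LIMSEQ_D[OF iter[of K], of "r / 3"] r by auto
    show "\<exists>no. \<forall>n\<ge>no. norm ((\<Sum>j<n. a 0 j - c) / real n - 0) < r"
    proof (intro exI allI impI)
      fix n assume "N \<le> n"
      have "\<bar>\<Sum>j<n. a K j - c\<bar> \<le> (\<Sum>j<n. r / 3)"
        by (rule order_trans[OF sum_abs]) (rule sum_mono, rule K)
      then have "\<bar>(\<Sum>j<n. a K j - c) / real n\<bar> \<le> r / 3"
        using r by (cases "n = 0") (auto simp: field_simps)
      moreover have "(\<Sum>j<n. a 0 j - c) / real n
          = (\<Sum>j<n. a 0 j - a K j) / real n + (\<Sum>j<n. a K j - c) / real n"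
        by (simp add: add_divide_distrib[symmetric] sum.distrib[symmetric])
      ultimately show "norm ((\<Sum>j<n. a 0 j - c) / real n - 0) < r"
        using N[OF \<open>N \<le> n\<close>] r unfolding real_norm_def diff_0_right by linarith
    qed
  qed
  moreover have "(\<lambda>n. a 0 n / real n) \<longlonglongrightarrow> 0" by (rule null) (rule bound)
  ultimately have "(\<lambda>n. (\<Sum>j<n. a 0 j - c) / real n + a 0 n / real n + c) \<longlonglongrightarrow> 0 + 0 + c"
    by (intro tendsto_intros)
  moreover have "\<forall>\<^sub>F n in sequentially. (\<Sum>j<n. a 0 j - c) / real n + a 0 n / real n + c
      = (\<Sum>j=0..n. a 0 j) / real n"
    using eventually_gt_at_top[of 0]
  proof eventually_elim
    case (elim n)
    have "(\<Sum>j=0..n. a 0 j) = (\<Sum>j<n. a 0 j) + a 0 n"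
      by (simp add: atLeast0AtMost lessThan_Suc_atMost[symmetric])
    with elim show ?case by (simp add: sum_subtractf field_simps)
  qed
  ultimately show ?thesis by (simp add: tendsto_cong)
qed

section \<open>A law of large numbers for orthogonal variables\<close>

lemma (in prob_space) integrable_bounded_real:
  fixes f :: "'a \<Rightarrow> real"
  assumes "f \<in> borel_measurable M" "\<And>x. \<bar>f x\<bar> \<le> B"
  shows "integrable M f"
  using assms by (intro integrable_const_bound[of _ B]) auto

lemma (in prob_space) expectation_close_to_const:
  fixes f :: "'a \<Rightarrow> real"
  assumes f: "f \<in> borel_measurable M" and close: "\<And>x. \<bar>f x - c\<bar> \<le> D"
  shows "\<bar>expectation f - c\<bar> \<le> D"
proof -
  have "\<bar>f x\<bar> \<le> \<bar>c\<bar> + D" for x using close[of x] by linarith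
  then have int: "integrable M f" by (rule integrable_bounded_real[OF f])
  have "f x \<le> c + D" "c - D \<le> f x" for x using close[of x] by linarith+
  then have "expectation f \<le> c + D" "c - D \<le> expectation f"
    by (auto intro!: integral_le_const[OF int] integral_ge_const[OF int])
  then show ?thesis by linarith
qed

lemma bounded_iterated_integrals:
  fixes f :: "'a \<times> 'b \<Rightarrow> real"
  assumes "prob_space M" "prob_space N"
    and f [measurable]: "f \<in> borel_measurable (M \<Otimes>\<^sub>M N)" and bound: "\<And>z. \<bar>f z\<bar> \<le> B"
  shows "(\<integral>x. \<integral>y. f (x, y) \<partial>N \<partial>M) = (\<integral>z. f z \<partial>(M \<Otimes>\<^sub>M N))"
    and "(\<integral>y. \<integral>x. f (x, y) \<partial>M \<partial>N) = (\<integral>z. f z \<partial>(M \<Otimes>\<^sub>M N))"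
proof -
  interpret M: prob_space M by fact
  interpret N: prob_space N by fact
  interpret pair_prob_space M N ..
  have "integrable (M \<Otimes>\<^sub>M N) f" by (rule integrable_bounded_real[OF f bound])
  then show "(\<integral>x. \<integral>y. f (x, y) \<partial>N \<partial>M) = (\<integral>z. f z \<partial>(M \<Otimes>\<^sub>M N))"
    "(\<integral>y. \<integral>x. f (x, y) \<partial>M \<partial>N) = (\<integral>z. f z \<partial>(M \<Otimes>\<^sub>M N))"
    using integral_fst'[of f] integral_snd[of "\<lambda>x y. f (x, y)"] by simp_all
qed

text \<open>
  Orthogonality makes the second moment of the sum of \<open>n\<close> terms grow linearly in \<open>n\<close>. Hence the squared
  averages over the first \<open>m\<^sup>2\<close> terms have means of order \<open>1 / m\<^sup>2\<close>, their sum is almost surely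
  finite, and the averages along squares tend to \<open>0\<close>.
\<close>

lemma (in prob_space) orthogonal_averages_tendsto_0:
  fixes D :: "nat \<Rightarrow> 'a \<Rightarrow> real"
  assumes meas [measurable]: "\<And>j. D j \<in> borel_measurable M"
    and bound: "\<And>j x. \<bar>D j x\<bar> \<le> C"
    and orth: "\<And>i j. i < j \<Longrightarrow> expectation (\<lambda>x. D i x * D j x) = 0"
  shows "AE x in M. (\<lambda>n. (\<Sum>j<n. D j x) / real n) \<longlonglongrightarrow> 0"
proof -
  have C: "0 \<le> C" using bound[of 0 undefined] by linarith
  have prod_bound: "\<bar>D i x * D j x\<bar> \<le> C\<^sup>2" for i j x
    unfolding abs_mult power2_eq_square by (intro mult_mono bound) (use C in auto)
  then have int: "integrable M (\<lambda>x. D i x * D j x)" for i j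
    by (intro integrable_bounded_real[of _ "C\<^sup>2"]) auto
  have orth': "expectation (\<lambda>x. D i x * D j x) = 0" if "i \<noteq> j" for i j
    using that orth[of i j] orth[of j i] by (cases "i < j") (auto simp: mult.commute)
  have square: "(\<Sum>j<n. D j x)\<^sup>2 = (\<Sum>i<n. \<Sum>j<n. D i x * D j x)" for n x
    by (simp add: power2_eq_square sum_product)
  have var: "expectation (\<lambda>x. (\<Sum>j<n. D j x)\<^sup>2) \<le> real n * C\<^sup>2" for n
  proof -
    have "expectation (\<lambda>x. (\<Sum>j<n. D j x)\<^sup>2) = (\<Sum>i<n. \<Sum>j<n. expectation (\<lambda>x. D i x * D j x))"
      unfolding square by (simp add: int)
    also have "\<dots> = (\<Sum>i<n. expectation (\<lambda>x. D i x * D i x))"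
    proof (rule sum.cong[OF refl])
      fix i assume "i \<in> {..<n}"
      have "(\<Sum>j<n. expectation (\<lambda>x. D i x * D j x))
          = (\<Sum>j<n. if j = i then expectation (\<lambda>x. D i x * D i x) else 0)"
        by (rule sum.cong) (auto simp: orth')
      with \<open>i \<in> {..<n}\<close> show "(\<Sum>j<n. expectation (\<lambda>x. D i x * D j x)) = expectation (\<lambda>x. D i x * D i x)"
        by simp
    qed
    also have "\<dots> \<le> (\<Sum>i<n. C\<^sup>2)"
    proof (rule sum_mono)
      fix i
      have "D i x * D i x \<le> C\<^sup>2" for x using prod_bound[of i x i] by linarith
      then show "expectation (\<lambda>x. D i x * D i x) \<le> C\<^sup>2"
        by (intro integral_le_const int) auto
    qed
    finally show ?thesis by simp
  qed
  let ?q = "\<lambda>m x. ((\<Sum>j<m\<^sup>2. D j x) / (real m)\<^sup>2)\<^sup>2"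
  have q: "(\<integral>\<^sup>+x. ennreal (?q m x) \<partial>M) \<le> ennreal (C\<^sup>2 * inverse ((real m)\<^sup>2))" for m
  proof -
    have sq_int: "integrable M (\<lambda>x. (\<Sum>j<m\<^sup>2. D j x)\<^sup>2)" unfolding square by (simp add: int)
    then have "integrable M (?q m)" unfolding power_divide by simp
    then have "(\<integral>\<^sup>+x. ennreal (?q m x) \<partial>M) = ennreal (expectation (?q m))"
      by (intro nn_integral_eq_integral) auto
    also have "expectation (?q m) = expectation (\<lambda>x. (\<Sum>j<m\<^sup>2. D j x)\<^sup>2) / ((real m)\<^sup>2)\<^sup>2"
      unfolding power_divide by simp
    also have "\<dots> \<le> (real (m\<^sup>2) * C\<^sup>2) / ((real m)\<^sup>2)\<^sup>2"
      by (intro divide_right_mono var) simp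
    also have "\<dots> = C\<^sup>2 * inverse ((real m)\<^sup>2)"
      by (cases "m = 0") (simp_all add: field_simps power2_eq_square)
    finally show ?thesis by (simp add: ennreal_leI)
  qed
  have "(\<integral>\<^sup>+x. (\<Sum>m. ennreal (?q m x)) \<partial>M) = (\<Sum>m. \<integral>\<^sup>+x. ennreal (?q m x) \<partial>M)"
    by (rule nn_integral_suminf) measurable
  also have "\<dots> \<le> (\<Sum>m. ennreal (C\<^sup>2 * inverse ((real m)\<^sup>2)))"
    by (intro suminf_le q summableI)
  also have "\<dots> = ennreal (\<Sum>m. C\<^sup>2 * inverse ((real m)\<^sup>2))"
    by (intro suminf_ennreal2 summable_mult inverse_power_summable) auto
  finally have "(\<integral>\<^sup>+x. (\<Sum>m. ennreal (?q m x)) \<partial>M) \<noteq> \<infinity>"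
    by (auto simp: top_unique)
  then have "AE x in M. (\<Sum>m. ennreal (?q m x)) \<noteq> \<infinity>"
    by (intro nn_integral_PInf_AE) measurable
  then show ?thesis
  proof eventually_elim
    case (elim x)
    then have "summable (\<lambda>m. ?q m x)" by (intro summable_suminf_not_top) auto
    then have "(\<lambda>m. ?q m x) \<longlonglongrightarrow> 0" by (rule summable_LIMSEQ_zero)
    from tendsto_real_sqrt[OF this]
    have "(\<lambda>m. \<bar>(\<Sum>j<m\<^sup>2. D j x) / (real m)\<^sup>2\<bar>) \<longlonglongrightarrow> 0" by simp
    then have "(\<lambda>m. (\<Sum>j<m\<^sup>2. D j x) / (real m)\<^sup>2) \<longlonglongrightarrow> 0" by (rule tendsto_rabs_zero_cancel)
    then show ?case by (rule square_averages_imp_averages[rotated]) (rule bound)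
  qed
qed

section \<open>Borel sets and measures on metric spaces\<close>

text \<open>
  The point \<open>c (k x)\<close> approximates \<open>x\<close> within \<open>e\<close> and depends on it through a discrete measurable variable:
  \<open>k x\<close> is the first index of a point of a finite \<open>e\<close>-net that is close enough to \<open>x\<close>.
\<close>

lemma compact_measurable_quantizer:
  assumes "compact (UNIV :: 'a::metric_space set)" and "0 < e"
  obtains c :: "nat \<Rightarrow> 'a::metric_space" and k :: "'a::metric_space \<Rightarrow> nat"
  where "k \<in> borel \<rightarrow>\<^sub>M count_space UNIV" "\<And>x. dist x (c (k x)) < e"
proof -
  obtain F where F: "finite F" "(UNIV :: 'a set) \<subseteq> (\<Union>x\<in>F. ball x e)"
    using assms unfolding compact_eq_totally_bounded by blast
  then have "F \<noteq> {}" by auto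
  define c where "c = from_nat_into F"
  have c: "range c = F"
    unfolding c_def using \<open>F \<noteq> {}\<close> F(1) by (simp add: range_from_nat_into countable_finite)
  have near: "\<exists>i. dist x (c i) < e" for x
  proof -
    obtain y where "y \<in> F" "dist y x < e" using F(2) by (auto simp: subset_iff)
    with c show ?thesis by (auto simp: dist_commute)
  qed
  show thesis
  proof (rule that)
    show "(\<lambda>x. LEAST i. dist x (c i) < e) \<in> borel \<rightarrow>\<^sub>M count_space UNIV"
    proof (rule measurable_Least)
      fix i
      have "open {x. dist x (c i) < e}" by (intro open_Collect_less continuous_intros)
      then show "Measurable.pred borel (\<lambda>x. dist x (c i) < e)"
        unfolding pred_def by simp
    qed
    show "dist x (c (LEAST i. dist x (c i) < e)) < e" for x
      using near by (rule LeastI_ex)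
  qed
qed

text \<open>
  The type classes of the factors give no countable base, so that the Borel sets of the product are not
  immediately known to lie in the product sigma-algebra. Compactness replaces the base: \<open>h\<close> is the pointwise
  limit of its compositions with the quantizers of the two factors, which are measurable
  because they are constant on each of countably many measurable rectangles.
\<close>

lemma continuous_pair_measurable:
  fixes h :: "'a::metric_space \<times> 'b::metric_space \<Rightarrow> 'c::metric_space"
  assumes "compact (UNIV :: 'a set)" "compact (UNIV :: 'b set)" and h: "continuous_on UNIV h"
  shows "h \<in> borel \<Otimes>\<^sub>M borel \<rightarrow>\<^sub>M borel"
proof -
  have "\<exists>c k. k \<in> borel \<rightarrow>\<^sub>M count_space UNIV \<and> (\<forall>x::'a. dist x (c (k x :: nat)) < 1 / real (Suc n))" for n
    by (rule compact_measurable_quantizer[OF assms(1), of "1 / real (Suc n)"]) auto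
  then obtain c k where k [measurable]: "\<And>n. k n \<in> borel \<rightarrow>\<^sub>M count_space UNIV"
    and c: "\<And>n x. dist x (c n (k n x :: nat) :: 'a) < 1 / real (Suc n)" by metis
  have "\<exists>c k. k \<in> borel \<rightarrow>\<^sub>M count_space UNIV \<and> (\<forall>x::'b. dist x (c (k x :: nat)) < 1 / real (Suc n))" for n
    by (rule compact_measurable_quantizer[OF assms(2), of "1 / real (Suc n)"]) auto
  then obtain d l where l [measurable]: "\<And>n. l n \<in> borel \<rightarrow>\<^sub>M count_space UNIV"
    and d: "\<And>n x. dist x (d n (l n x :: nat) :: 'b) < 1 / real (Suc n)" by metis
  have conv: "u \<longlonglongrightarrow> x" if "\<And>n. dist x (u n) < 1 / real (Suc n)" for x :: "'d::metric_space" and u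
  proof -
    have "(\<lambda>n. 1 / real (Suc n)) \<longlonglongrightarrow> 0"
      by (rule LIMSEQ_Suc[OF lim_1_over_n])
    moreover have "\<forall>\<^sub>F n in sequentially. norm (dist (u n) x) \<le> 1 / real (Suc n)"
    proof (intro always_eventually allI)
      fix n
      show "norm (dist (u n) x) \<le> 1 / real (Suc n)"
        using that[of n] by (simp only: real_norm_def abs_of_nonneg[OF zero_le_dist] dist_commute less_imp_le)
    qed
    ultimately show ?thesis unfolding tendsto_dist_iff[of u] by (rule Lim_null_comparison[rotated])
  qed
  show ?thesis
  proof (rule borel_measurable_LIMSEQ_metric)
    fix n
    show "(\<lambda>z. h (c n (k n (fst z)), d n (l n (snd z)))) \<in> borel \<Otimes>\<^sub>M borel \<rightarrow>\<^sub>M borel"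
    proof (rule measurable_compose_countable[where f = "\<lambda>i z. h (c n i, d n (l n (snd z)))" and g = "\<lambda>z. k n (fst z)"])
      fix i
      show "(\<lambda>z. h (c n i, d n (l n (snd z)))) \<in> borel \<Otimes>\<^sub>M borel \<rightarrow>\<^sub>M borel"
        by (rule measurable_compose_countable[where f = "\<lambda>j z. h (c n i, d n j)" and g = "\<lambda>z. l n (snd z)"])
          measurable
    qed measurable
  next
    fix z :: "'a \<times> 'b"
    have "(\<lambda>n. (c n (k n (fst z)), d n (l n (snd z)))) \<longlonglongrightarrow> (fst z, snd z)"
      by (intro tendsto_Pair conv c d)
    then show "(\<lambda>n. h (c n (k n (fst z)), d n (l n (snd z)))) \<longlonglongrightarrow> h z"
      using continuous_on_tendsto_compose[OF h, of "\<lambda>n. (c n (k n (fst z)), d n (l n (snd z)))" "(fst z, snd z)"]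
      by simp
  qed
qed

text \<open>
  The indicator of an open set \<open>U\<close> is the increasing limit of \<open>min 1 (n d(x, -U))\<close>, which is
  Lipschitz with constant \<open>n\<close>; and the open sets generate the Borel sets and are closed under
  intersection.
\<close>

lemma borel_prob_eq_if_Lipschitz_integrals_eq:
  fixes M N :: "'a::metric_space measure"
  assumes M: "M \<in> borel_prob_measures" and N: "N \<in> borel_prob_measures"
    and eq: "\<And>f :: 'a \<Rightarrow> real. (\<And>x y. \<bar>f x - f y\<bar> \<le> dist x y) \<Longrightarrow> (\<integral>x. f x \<partial>M) = (\<integral>x. f x \<partial>N)"
  shows "M = N"
proof -
  interpret M: prob_space M using M by (simp add: borel_prob_measures_def)
  interpret N: prob_space N using N by (simp add: borel_prob_measures_def)
  have sets [measurable_cong]: "sets M = sets borel" "sets N = sets borel"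
    using M N by (simp_all add: borel_prob_measures_def)
  have [simp]: "space M = UNIV" "space N = UNIV" using sets[THEN sets_eq_imp_space_eq] by simp_all
  have open_eq: "emeasure M U = emeasure N U" if "open U" for U
  \<comment> \<open>The distance to the empty complement of the whole space has the default value 0, so this case is separate.\<close>
  proof (cases "U = UNIV")
    case True
    then show ?thesis using M.emeasure_space_1 N.emeasure_space_1 by simp
  next
    case False
    define g where "g n x = min 1 (real n * infdist x (-U))" for n x
    have cont: "continuous_on UNIV (g n)" for n
      unfolding g_def by (intro continuous_intros)
    then have [measurable]: "g n \<in> borel_measurable borel" for n
      by (rule borel_measurable_continuous_onI)
    have g_eq: "(\<integral>x. g n x \<partial>M) = (\<integral>x. g n x \<partial>N)" for n
    proof (cases "n = 0")
      case n: False
      have "\<bar>g n x / real n - g n y / real n\<bar> \<le> dist x y" for x y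
      proof -
        have "\<bar>g n x - g n y\<bar> \<le> \<bar>real n * infdist x (-U) - real n * infdist y (-U)\<bar>"
          unfolding g_def by linarith
        also have "\<dots> = real n * \<bar>infdist x (-U) - infdist y (-U)\<bar>"
          by (simp add: abs_mult right_diff_distrib[symmetric])
        also have "\<dots> \<le> real n * dist x y"
          by (intro mult_left_mono infdist_triangle_abs) simp
        finally show ?thesis
          using n by (simp add: diff_divide_distrib[symmetric] divide_le_eq mult.commute)
      qed
      from eq[of "\<lambda>x. g n x / real n", OF this] n show ?thesis by simp
    qed (simp add: g_def)
    have lim: "(\<lambda>n. g n x) \<longlonglongrightarrow> indicator U x" for x
    proof (cases "x \<in> U")
      case True
      have "0 < infdist x (-U)"
        using that False True infdist_pos_not_in_closed[of "-U" x] by auto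
      then obtain n0 where n0: "1 < real n0 * infdist x (-U)" using ex_less_of_nat_mult by blast
      have "g n x = 1" if "n0 \<le> n" for n
      proof -
        have "real n0 * infdist x (-U) \<le> real n * infdist x (-U)"
          using that by (intro mult_right_mono infdist_nonneg) simp
        with n0 show ?thesis by (simp add: g_def)
      qed
      then have "\<forall>\<^sub>F n in sequentially. g n x = 1" by (auto simp: eventually_sequentially)
      with True show ?thesis by (simp add: tendsto_eventually)
    qed (simp add: g_def)
    have int_lim: "(\<lambda>n. \<integral>x. g n x \<partial>L) \<longlonglongrightarrow> measure L U"
      if "prob_space L" and [measurable_cong]: "sets L = sets borel" for L
    proof -
      interpret L: prob_space L by fact
      have [simp]: "space L = UNIV" using sets_eq_imp_space_eq[of L borel] that(2) by simp
      have [measurable]: "U \<in> sets L" using that(2) \<open>open U\<close> by simp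
      have "(\<lambda>n. \<integral>x. g n x \<partial>L) \<longlonglongrightarrow> (\<integral>x. indicator U x \<partial>L)"
      proof (rule integral_dominated_convergence[where w = "\<lambda>_. 1"])
        show "AE x in L. norm (g n x) \<le> 1" for n
          by (simp add: g_def infdist_nonneg)
      qed (auto simp: lim)
      then show ?thesis by simp
    qed
    have "measure M U = measure N U"
      using int_lim[OF M.prob_space_axioms sets(1)] int_lim[OF N.prob_space_axioms sets(2)]
      unfolding g_eq by (rule LIMSEQ_unique)
    then show ?thesis by (simp add: M.emeasure_eq_measure N.emeasure_eq_measure)
  qed
  show ?thesis
  proof (rule measure_eqI_generator_eq[where E = "{U. open U}" and \<Omega> = UNIV and A = "\<lambda>_. UNIV"])
    show "Int_stable {U :: 'a set. open U}" by (auto simp: Int_stable_def)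
    show "sets M = sigma_sets UNIV {U. open U}" "sets N = sigma_sets UNIV {U. open U}"
      by (simp_all add: sets borel_def)
  qed (use open_eq in auto)
qed

section \<open>Words and their addresses\<close>

text \<open>
  A word can be extended at its front by composing with the new map on the outside. This is the form of the
  recursion that fits the decomposition of the product measure into its first factor and the rest.
\<close>

lemma word_map_case_nat: "word_map w (case_nat l \<sigma>) (Suc n) x = w l (word_map w \<sigma> n x)"
  by (induction n arbitrary: x) simp_all

lemma word_map_range_antimono:
  assumes "n \<le> m"
  shows "range (word_map w \<sigma> m) \<subseteq> range (word_map w \<sigma> n)"
  using assms by (induction rule: dec_induct) auto

text \<open>
  The orbit up to time \<open>j\<close> depends on the first \<open>j\<close> letters only: it is adapted to the natural filtration.
\<close>

lemma random_orbit_comb_seq: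
  "j \<le> n \<Longrightarrow> random_orbit w (comb_seq n \<sigma> \<sigma>') j x = random_orbit w \<sigma> j x"
  by (induction j) (simp_all add: comb_seq_less)

locale weakly_hyperbolic_ifs =
  fixes w :: "'l::metric_space \<Rightarrow> 'x::metric_space \<Rightarrow> 'x"
    and p :: "'l measure"
  assumes compact_X: "compact (UNIV :: 'x set)"
    and compact_L: "compact (UNIV :: 'l set)"
    and w_cont: "continuous_on UNIV (\<lambda>(l, x). w l x)"
    and wh: "weakly_hyperbolic w"
    and p: "p \<in> borel_prob_measures"
begin

lemma prob_space_p: "prob_space p"
  using p by (simp add: borel_prob_measures_def)

lemma sets_p [measurable_cong]: "sets p = sets borel"
  using p by (simp add: borel_prob_measures_def)

lemma space_p [simp]: "space p = UNIV"
  using sets_eq_imp_space_eq[OF sets_p] by simp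

sublocale sequence_space p
  by (simp add: sequence_space_def product_prob_space_def product_sigma_finite_def
      product_prob_space_axioms_def prob_space_p prob_space_imp_sigma_finite)

lemma space_S [simp]: "space S = UNIV"
  by (simp add: space_PiM)

lemma w_continuous [continuous_intros]:
  assumes "continuous_on A f" "continuous_on A g"
  shows "continuous_on A (\<lambda>z. w (f z) (g z))"
  using continuous_on_compose2[OF w_cont continuous_on_Pair[OF assms]] by simp

lemma word_map_continuous:
  assumes "continuous_on A s" "continuous_on A y"
  shows "continuous_on A (\<lambda>z. word_map w (s z) n (y z))"
  using assms(2)
proof (induction n arbitrary: y)
  case (Suc n)
  have "continuous_on A (\<lambda>z. w (s z n) (y z))"
    by (intro w_continuous Suc.prems continuous_on_product_then_coordinatewise[OF assms(1)])
  from Suc.IH[OF this] show ?case by simp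
qed simp

lemma w_measurable [measurable (raw)]:
  assumes [measurable]: "f \<in> borel_measurable M" "g \<in> borel_measurable M"
  shows "(\<lambda>z. w (f z) (g z)) \<in> borel_measurable M"
proof -
  have [measurable]: "(\<lambda>(l, x). w l x) \<in> borel \<Otimes>\<^sub>M borel \<rightarrow>\<^sub>M borel"
    by (rule continuous_pair_measurable[OF compact_L compact_X w_cont])
  have "(\<lambda>z. (\<lambda>(l, x). w l x) (f z, g z)) \<in> borel_measurable M" by measurable
  then show ?thesis by simp
qed

lemma letter_measurable:
  assumes "s \<in> M \<rightarrow>\<^sub>M S"
  shows "(\<lambda>z. s z i) \<in> borel_measurable M"
  using measurable_compose[OF assms measurable_component_singleton[of i UNIV "\<lambda>_. p"]]
  by (simp add: measurable_cong_sets[OF refl sets_p])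

lemma word_map_measurable [measurable (raw)]:
  assumes [measurable]: "s \<in> M \<rightarrow>\<^sub>M S" and "y \<in> borel_measurable M"
  shows "(\<lambda>z. word_map w (s z) n (y z)) \<in> borel_measurable M"
  using assms(2)
proof (induction n arbitrary: y)
  case (Suc n)
  note [measurable] = Suc.prems letter_measurable[OF assms(1)]
  have "(\<lambda>z. w (s z n) (y z)) \<in> borel_measurable M" by measurable
  from Suc.IH[OF this] show ?case by simp
qed simp

lemma random_orbit_measurable [measurable (raw)]:
  assumes [measurable]: "s \<in> M \<rightarrow>\<^sub>M S"
  shows "(\<lambda>z. random_orbit w (s z) j x) \<in> borel_measurable M"
proof (induction j)
  case (Suc j)
  note [measurable] = Suc letter_measurable[OF assms]
  show ?case by simp
qed simp

lemma compact_words: "compact (UNIV :: (nat \<Rightarrow> 'l) set)"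
proof -
  have "compact_space (product_topology (\<lambda>_. euclidean :: 'l topology) (UNIV :: nat set))"
    unfolding compact_space_product_topology using compact_L by (simp add: compact_space_def)
  then show ?thesis by (simp add: euclidean_product_topology compact_space_def)
qed

text \<open>
  The words whose \<open>n\<close>-th image has two points at distance at least \<open>e\<close> form a closed set, as the projection
  of a compact set of triples. These sets decrease with \<open>n\<close>. If none were empty, compactness would
  give a word lying in all of them, and this word would violate weak hyperbolicity.
\<close>

lemma uniform_contraction:
  assumes e: "0 < e"
  obtains N where "\<And>n \<sigma> x y. N \<le> n \<Longrightarrow> dist (word_map w \<sigma> n x) (word_map w \<sigma> n y) < e"
proof -
  define F where "F n = {\<sigma>. \<exists>x y. e \<le> dist (word_map w \<sigma> n x) (word_map w \<sigma> n y)}" for n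
  have closed: "closed (F n)" for n
  proof -
    define Z :: "((nat \<Rightarrow> 'l) \<times> 'x \<times> 'x) set" where
      "Z = {(\<sigma>, x, y). e \<le> dist (word_map w \<sigma> n x) (word_map w \<sigma> n y)}"
    have 1: "continuous_on UNIV (\<lambda>z :: (nat \<Rightarrow> 'l) \<times> 'x \<times> 'x. word_map w (fst z) n (fst (snd z)))"
      by (rule word_map_continuous) (intro continuous_intros)+
    have 2: "continuous_on UNIV (\<lambda>z :: (nat \<Rightarrow> 'l) \<times> 'x \<times> 'x. word_map w (fst z) n (snd (snd z)))"
      by (rule word_map_continuous) (intro continuous_intros)+
    have "closed {z :: (nat \<Rightarrow> 'l) \<times> 'x \<times> 'x.
        e \<le> dist (word_map w (fst z) n (fst (snd z))) (word_map w (fst z) n (snd (snd z)))}"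
      by (rule closed_Collect_le[OF continuous_on_const continuous_on_dist[OF 1 2]])
    also have "{z :: (nat \<Rightarrow> 'l) \<times> 'x \<times> 'x.
        e \<le> dist (word_map w (fst z) n (fst (snd z))) (word_map w (fst z) n (snd (snd z)))} = Z"
      by (auto simp: Z_def)
    finally have "closed Z" .
    moreover have "compact (UNIV :: ((nat \<Rightarrow> 'l) \<times> 'x \<times> 'x) set)"
      using compact_Times[OF compact_words compact_Times[OF compact_X compact_X]] by simp
    ultimately have "compact Z"
      using compact_Int_closed by fastforce
    then have "compact (fst ` Z)"
      by (rule compact_continuous_image[OF continuous_on_fst[OF continuous_on_id]])
    also have "fst ` Z = F n"
      by (force simp: F_def Z_def image_iff)
    finally show ?thesis by (rule compact_imp_closed)
  qed
  have nested: "F m \<subseteq> F n" if "n \<le> m" for n m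
  proof
    fix \<sigma> assume "\<sigma> \<in> F m"
    then obtain x y where xy: "e \<le> dist (word_map w \<sigma> m x) (word_map w \<sigma> m y)"
      by (auto simp: F_def)
    have "word_map w \<sigma> m z \<in> range (word_map w \<sigma> n)" for z
      using subsetD[OF word_map_range_antimono[OF that] rangeI] .
    then obtain x' y' where x': "word_map w \<sigma> m x = word_map w \<sigma> n x'"
      and y': "word_map w \<sigma> m y = word_map w \<sigma> n y'" by blast
    from xy have "e \<le> dist (word_map w \<sigma> n x') (word_map w \<sigma> n y')" unfolding x' y' .
    then show "\<sigma> \<in> F n" unfolding F_def by blast
  qed
  have "\<exists>n. F n = {}"
  proof (rule ccontr)
    assume ne: "\<nexists>n. F n = {}"
    have "(\<Inter>n. F n) \<noteq> {}"
    proof (rule compact_space_imp_nest[of euclidean])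
      show "decseq F" using nested by (auto simp: decseq_def)
    qed (use ne closed compact_words in \<open>auto simp: compact_space_def\<close>)
    then obtain \<sigma> where \<sigma>: "\<And>n. \<sigma> \<in> F n" by auto
    have "e \<le> diameter (word_map w \<sigma> n ` UNIV)" for n
    proof -
      obtain x y where "e \<le> dist (word_map w \<sigma> n x) (word_map w \<sigma> n y)"
        using \<sigma>[of n] by (auto simp: F_def)
      also have "\<dots> \<le> diameter (word_map w \<sigma> n ` UNIV)"
        using bounded_subset[OF compact_imp_bounded[OF compact_X]]
        by (intro diameter_bounded_bound) auto
      finally show ?thesis .
    qed
    moreover have "(\<lambda>n. diameter (word_map w \<sigma> n ` UNIV)) \<longlonglongrightarrow> 0"
      using wh by (simp add: weakly_hyperbolic_def)
    ultimately have "e \<le> 0" by (intro LIMSEQ_le_const) auto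
    with e show False by simp
  qed
  then obtain N where "F N = {}" ..
  show thesis
  proof (rule that)
    fix n \<sigma> x y assume "N \<le> n"
    then have "\<sigma> \<notin> F n" using nested[of N n] \<open>F N = {}\<close> by auto
    then show "dist (word_map w \<sigma> n x) (word_map w \<sigma> n y) < e"
      by (auto simp: F_def not_le)
  qed
qed

text \<open>
  The base point \<open>undefined\<close> is arbitrary: the images of \<open>X\<close> shrink to a point, so every base point gives the
  same limit.
\<close>

definition address :: "(nat \<Rightarrow> 'l) \<Rightarrow> 'x" where
  "address \<sigma> = Topological_Spaces.lim (\<lambda>n. word_map w \<sigma> n undefined)"

lemma word_map_tendsto_address: "(\<lambda>n. word_map w \<sigma> n undefined) \<longlonglongrightarrow> address \<sigma>"
proof -
  have "Cauchy (\<lambda>n. word_map w \<sigma> n undefined)"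
  proof (rule metric_CauchyI)
    fix e :: real assume "0 < e"
    then obtain N where N: "\<And>n \<sigma> x y. N \<le> n \<Longrightarrow> dist (word_map w \<sigma> n x) (word_map w \<sigma> n y) < e"
      by (rule uniform_contraction) blast
    have "\<exists>x. word_map w \<sigma> m undefined = word_map w \<sigma> N x" if "N \<le> m" for m
      using subsetD[OF word_map_range_antimono[OF that] rangeI] by (rule imageE) blast
    then show "\<exists>M. \<forall>m\<ge>M. \<forall>n\<ge>M. dist (word_map w \<sigma> m undefined) (word_map w \<sigma> n undefined) < e"
      by (metis N order_refl)
  qed
  then have "convergent (\<lambda>n. word_map w \<sigma> n undefined)"
    using compact_imp_complete[OF compact_X] unfolding complete_def convergent_def by blast
  then show ?thesis by (simp add: address_def convergent_LIMSEQ_iff)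
qed

text \<open>
  This places the address among the points that the contraction estimates compare: for every \<open>n\<close>
  both it and \<open>w\<^bsub>\<sigma>1\<dots>\<sigma>n\<^esub>(x)\<close> lie in the image of the word of length \<open>n\<close>.
\<close>

lemma address_in_range: "address \<sigma> \<in> range (word_map w \<sigma> n)"
proof (rule closed_sequentially)
  show "closed (range (word_map w \<sigma> n))"
    by (intro compact_imp_closed compact_continuous_image compact_X word_map_continuous) auto
  show "(\<lambda>m. word_map w \<sigma> (m + n) undefined) \<longlonglongrightarrow> address \<sigma>"
    by (rule LIMSEQ_ignore_initial_segment) (rule word_map_tendsto_address)
  show "word_map w \<sigma> (m + n) undefined \<in> range (word_map w \<sigma> n)" for m
    by (rule subsetD[OF word_map_range_antimono rangeI]) simp
qed

lemma address_measurable [measurable]: "address \<in> S \<rightarrow>\<^sub>M borel"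
  by (rule borel_measurable_LIMSEQ_metric[OF _ word_map_tendsto_address]) measurable

definition stationary :: "'x measure" where
  "stationary = distr S borel address"

lemma stationary_prob: "stationary \<in> borel_prob_measures"
  using P.prob_space_distr[of address borel]
  by (simp add: borel_prob_measures_def stationary_def)

section \<open>The transition operator\<close>

definition trans_op :: "('x \<Rightarrow> real) \<Rightarrow> 'x \<Rightarrow> real" where
  "trans_op f x = (\<integral>l. f (w l x) \<partial>p)"

lemma trans_op_measurable [measurable]:
  assumes [measurable]: "f \<in> borel_measurable borel"
  shows "trans_op f \<in> borel_measurable borel"
  unfolding trans_op_def[abs_def] by measurable

lemma trans_op_bounded:
  assumes [measurable]: "f \<in> borel_measurable borel" and bound: "\<And>x. \<bar>f x\<bar> \<le> B"
  shows "\<bar>trans_op f x\<bar> \<le> B"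
proof -
  have "(\<lambda>l. f (w l x)) \<in> borel_measurable p" by measurable
  from prob_space.expectation_close_to_const[OF prob_space_p this, of 0 B] show ?thesis
    using bound by (simp add: trans_op_def)
qed

lemma trans_op_funpow_measurable:
  "f \<in> borel_measurable borel \<Longrightarrow> (trans_op ^^ n) f \<in> borel_measurable borel"
  by (induction n) (simp_all add: trans_op_measurable)

lemma trans_op_funpow_bounded:
  "f \<in> borel_measurable borel \<Longrightarrow> (\<And>x. \<bar>f x\<bar> \<le> B) \<Longrightarrow> \<bar>(trans_op ^^ n) f x\<bar> \<le> B"
  by (induction n arbitrary: x) (simp_all add: trans_op_bounded trans_op_funpow_measurable)

text \<open>
  Iterating the operator produces independent letters one at a time. They may be collected
  in either order of composition, because the letters are independent and identically distributed; the order used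
  here is the one in which images are nested.
\<close>

lemma trans_op_funpow_eq:
  assumes "f \<in> borel_measurable borel" "\<And>x. \<bar>f x\<bar> \<le> B"
  shows "(trans_op ^^ n) f x = (\<integral>\<sigma>. f (word_map w \<sigma> n x) \<partial>S)"
  using assms
proof (induction n arbitrary: f)
  case 0
  then show ?case using P.prob_space by simp
next
  case (Suc n)
  note [measurable] = Suc.prems(1)
  have "(trans_op ^^ Suc n) f x = (trans_op ^^ n) (trans_op f) x"
    by (simp add: funpow_swap1)
  also have "\<dots> = (\<integral>\<sigma>. \<integral>l. f (w l (word_map w \<sigma> n x)) \<partial>p \<partial>S)"
    by (subst Suc.IH) (auto simp: trans_op_def[symmetric] trans_op_bounded Suc.prems)
  also have "\<dots> = (\<integral>z. f (w (fst z) (word_map w (snd z) n x)) \<partial>(p \<Otimes>\<^sub>M S))"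
    using bounded_iterated_integrals(2)[OF prob_space_p P.prob_space_axioms,
        of "\<lambda>z. f (w (fst z) (word_map w (snd z) n x))" B] Suc.prems(2) by simp
  also have "\<dots> = (\<integral>z. f (word_map w (case z of (l, \<sigma>) \<Rightarrow> case_nat l \<sigma>) (Suc n) x) \<partial>(p \<Otimes>\<^sub>M S))"
    by (simp only: word_map_case_nat split_beta)
  also have "\<dots> = (\<integral>\<sigma>. f (word_map w \<sigma> (Suc n) x) \<partial>distr (p \<Otimes>\<^sub>M S) S (\<lambda>(l, \<sigma>). case_nat l \<sigma>))"
    by (rule integral_distr[symmetric]) measurable
  finally show ?case unfolding PiM_iter .
qed

text \<open>
  Both quantities are means over random words, of \<open>f (w\<^bsub>\<sigma>1\<dots>\<sigma>n\<^esub>(x))\<close> and of \<open>f\<close> at the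
  address of \<open>\<sigma>\<close>; and for each \<open>\<sigma>\<close> the two points lie in the same image of \<open>X\<close>.
\<close>

lemma trans_op_funpow_close:
  assumes [measurable]: "f \<in> borel_measurable borel" and bound: "\<And>x. \<bar>f x\<bar> \<le> B"
    and osc: "\<And>\<sigma> x y. \<bar>f (word_map w \<sigma> n x) - f (word_map w \<sigma> n y)\<bar> \<le> e"
  shows "\<bar>(trans_op ^^ n) f x - (\<integral>y. f y \<partial>stationary)\<bar> \<le> e"
proof -
  have close: "\<bar>f (word_map w \<sigma> n x) - f (address \<sigma>)\<bar> \<le> e" for \<sigma>
    using address_in_range[of \<sigma> n] osc[of \<sigma> x] by auto
  have "(trans_op ^^ n) f x - (\<integral>y. f y \<partial>stationary)
      = (\<integral>\<sigma>. f (word_map w \<sigma> n x) \<partial>S) - (\<integral>\<sigma>. f (address \<sigma>) \<partial>S)"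
    by (simp add: trans_op_funpow_eq[OF assms(1) bound] stationary_def integral_distr)
  also have "\<dots> = (\<integral>\<sigma>. f (word_map w \<sigma> n x) - f (address \<sigma>) \<partial>S)"
    by (intro Bochner_Integration.integral_diff[symmetric] P.integrable_bounded_real[OF _ bound]) measurable
  finally show ?thesis
    using P.expectation_close_to_const[of "\<lambda>\<sigma>. f (word_map w \<sigma> n x) - f (address \<sigma>)" 0 e] close by simp
qed

section \<open>The measure attractor\<close>

text \<open>
  Seen as the image of a product measure, the value of the transfer operator is countably additive and its integrals
  are computed by Fubini's theorem.
\<close>

lemma transfer_op_eq_distr:
  assumes mu: "\<mu> \<in> borel_prob_measures"
  shows "transfer_op w p \<mu> = distr (p \<Otimes>\<^sub>M \<mu>) borel (\<lambda>(l, x). w l x)"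
proof -
  interpret mu: prob_space \<mu> using mu by (simp add: borel_prob_measures_def)
  have [measurable_cong]: "sets \<mu> = sets borel" using mu by (simp add: borel_prob_measures_def)
  then have [simp]: "space \<mu> = UNIV" using sets_eq_imp_space_eq[of \<mu> borel] by simp
  let ?D = "distr (p \<Otimes>\<^sub>M \<mu>) borel (\<lambda>(l, x). w l x)"
  have meas: "(\<lambda>(l, x). w l x) \<in> p \<Otimes>\<^sub>M \<mu> \<rightarrow>\<^sub>M borel" by measurable
  have "transfer_op w p \<mu> = measure_of UNIV (sets borel) (emeasure ?D)"
    unfolding transfer_op_def
  proof (rule measure_of_eq)
    fix B :: "'x set" assume "B \<in> sigma_sets UNIV (sets borel)"
    then have B: "B \<in> sets borel" using sets.sigma_sets_eq[of "borel :: 'x measure"] by simp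
    have "emeasure ?D B = emeasure (p \<Otimes>\<^sub>M \<mu>) ((\<lambda>(l, x). w l x) -` B)"
      using emeasure_distr[OF meas B] by (simp add: space_pair_measure)
    also have "\<dots> = (\<integral>\<^sup>+l. emeasure \<mu> (Pair l -` (\<lambda>(l, x). w l x) -` B) \<partial>p)"
      using measurable_sets[OF meas B] by (intro mu.emeasure_pair_measure_alt) (simp add: space_pair_measure)
    also have "\<dots> = (\<integral>\<^sup>+l. emeasure \<mu> (w l -` B) \<partial>p)"
      by (simp add: vimage_def)
    finally show "(\<integral>\<^sup>+l. emeasure \<mu> (w l -` B) \<partial>p) = emeasure ?D B" ..
  qed simp
  also have "\<dots> = ?D" using measure_of_of_measure[of ?D] by simp
  finally show ?thesis .
qed

lemma transfer_op_prob:
  assumes mu: "\<mu> \<in> borel_prob_measures"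
  shows "transfer_op w p \<mu> \<in> borel_prob_measures"
proof -
  interpret mu: prob_space \<mu> using mu by (simp add: borel_prob_measures_def)
  have [measurable_cong]: "sets \<mu> = sets borel" using mu by (simp add: borel_prob_measures_def)
  interpret pair: pair_prob_space p \<mu>
    using prob_space_p mu.prob_space_axioms
    by (simp add: pair_prob_space_def pair_sigma_finite_def prob_space_imp_sigma_finite)
  have "prob_space (distr (p \<Otimes>\<^sub>M \<mu>) borel (\<lambda>(l, x). w l x))"
    by (rule pair.prob_space_distr) measurable
  then show ?thesis
    by (simp add: transfer_op_eq_distr[OF mu]) (simp add: borel_prob_measures_def)
qed

lemma integral_transfer_op:
  assumes mu: "\<mu> \<in> borel_prob_measures"
    and f [measurable]: "f \<in> borel_measurable borel" and bound: "\<And>x. \<bar>f x\<bar> \<le> B"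
  shows "(\<integral>x. f x \<partial>transfer_op w p \<mu>) = (\<integral>x. trans_op f x \<partial>\<mu>)"
proof -
  have prob: "prob_space \<mu>" using mu by (simp add: borel_prob_measures_def)
  have [measurable_cong]: "sets \<mu> = sets borel" using mu by (simp add: borel_prob_measures_def)
  have "(\<integral>x. f x \<partial>transfer_op w p \<mu>) = (\<integral>z. f (w (fst z) (snd z)) \<partial>(p \<Otimes>\<^sub>M \<mu>))"
    unfolding transfer_op_eq_distr[OF mu] by (subst integral_distr) (measurable, simp add: split_beta)
  also have "\<dots> = (\<integral>x. \<integral>l. f (w l x) \<partial>p \<partial>\<mu>)"
    using bounded_iterated_integrals(2)[OF prob_space_p prob, of "\<lambda>z. f (w (fst z) (snd z))" B] bound
    by simp
  finally show ?thesis by (simp add: trans_op_def)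
qed

lemma transfer_op_funpow_prob:
  "\<mu> \<in> borel_prob_measures \<Longrightarrow> (transfer_op w p ^^ n) \<mu> \<in> borel_prob_measures"
  by (induction n) (simp_all add: transfer_op_prob)

lemma integral_transfer_op_funpow:
  assumes mu: "\<mu> \<in> borel_prob_measures"
    and f: "f \<in> borel_measurable borel" and bound: "\<And>x. \<bar>f x\<bar> \<le> B"
  shows "(\<integral>x. f x \<partial>(transfer_op w p ^^ n) \<mu>) = (\<integral>x. (trans_op ^^ n) f x \<partial>\<mu>)"
  using f bound
proof (induction n arbitrary: f)
  case (Suc n)
  have "(\<integral>x. f x \<partial>(transfer_op w p ^^ Suc n) \<mu>) = (\<integral>x. trans_op f x \<partial>(transfer_op w p ^^ n) \<mu>)"
    using integral_transfer_op[OF transfer_op_funpow_prob[OF mu] Suc.prems] by simp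
  also have "\<dots> = (\<integral>x. (trans_op ^^ n) (trans_op f) x \<partial>\<mu>)"
    by (intro Suc.IH trans_op_measurable trans_op_bounded Suc.prems)
  finally show ?case by (simp add: funpow_swap1)
qed simp

lemma Lipschitz_measurable_bounded:
  fixes f :: "'x \<Rightarrow> real"
  assumes lip: "\<And>x y. \<bar>f x - f y\<bar> \<le> dist x y"
  shows "f \<in> borel_measurable borel" and "\<bar>f x - f y\<bar> \<le> diameter (UNIV :: 'x set)"
proof -
  have "continuous_on UNIV f"
    unfolding continuous_on_iff using lip by (metis dist_commute dist_real_def le_less_trans)
  then show "f \<in> borel_measurable borel" by (rule borel_measurable_continuous_onI)
  have "dist x y \<le> diameter (UNIV :: 'x set)"
    by (intro diameter_bounded_bound compact_imp_bounded compact_X) auto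
  with lip[of x y] show "\<bar>f x - f y\<bar> \<le> diameter (UNIV :: 'x set)" by linarith
qed

text \<open>
  Since the Hutchinson distance is a supremum of reals, this needs the set of values to be bounded. A 1-Lipschitz
  function is within the diameter of \<open>X\<close> of any one of its values, hence so is its mean under any
  Borel probability measure.
\<close>

lemma integral_diff_le_hutchinson_dist:
  fixes f :: "'x \<Rightarrow> real"
  assumes \<alpha>: "\<alpha> \<in> borel_prob_measures" and \<beta>: "\<beta> \<in> borel_prob_measures"
    and lip: "\<And>x y. \<bar>f x - f y\<bar> \<le> dist x y"
  shows "\<bar>(\<integral>x. f x \<partial>\<alpha>) - (\<integral>x. f x \<partial>\<beta>)\<bar> \<le> hutchinson_dist \<alpha> \<beta>"
  unfolding hutchinson_dist_def
proof (rule cSUP_upper)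
  show "bdd_above ((\<lambda>f. \<bar>(\<integral>x. f x \<partial>\<alpha>) - (\<integral>x. f x \<partial>\<beta>)\<bar>) `
      {f :: 'x \<Rightarrow> real. \<forall>x y. \<bar>f x - f y\<bar> \<le> dist x y})"
  proof (rule bdd_aboveI2)
    fix g :: "'x \<Rightarrow> real" assume "g \<in> {f. \<forall>x y. \<bar>f x - f y\<bar> \<le> dist x y}"
    then have g: "\<And>x y. \<bar>g x - g y\<bar> \<le> dist x y" by simp
    have "\<bar>(\<integral>x. g x \<partial>M) - g undefined\<bar> \<le> diameter (UNIV :: 'x set)"
      if "M \<in> borel_prob_measures" for M
    proof (rule prob_space.expectation_close_to_const)
      show "prob_space M" using that by (simp add: borel_prob_measures_def)
      have [measurable_cong]: "sets M = sets borel" using that by (simp add: borel_prob_measures_def)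
      note [measurable] = Lipschitz_measurable_bounded(1)[OF g]
      show "g \<in> borel_measurable M" by measurable
    qed (rule Lipschitz_measurable_bounded(2)[OF g])
    from this[OF \<alpha>] this[OF \<beta>]
    show "\<bar>(\<integral>x. g x \<partial>\<alpha>) - (\<integral>x. g x \<partial>\<beta>)\<bar> \<le> 2 * diameter (UNIV :: 'x set)"
      by linarith
  qed
qed (use lip in simp)

text \<open>
  For a 1-Lipschitz function the oscillation on a set is at most the diameter of the set, so the bound of
  \<open>trans_op_funpow_close\<close> is the same for all the functions in the supremum.
\<close>

lemma stationary_is_attractor: "is_measure_attractor w p stationary"
  unfolding is_measure_attractor_def
proof (intro conjI ballI stationary_prob LIMSEQ_I)
  fix \<mu> :: "'x measure" and r :: real
  assume mu: "\<mu> \<in> borel_prob_measures" and r: "0 < r"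
  have prob: "prob_space \<mu>" using mu by (simp add: borel_prob_measures_def)
  have sets_mu [measurable_cong]: "sets \<mu> = sets borel" using mu by (simp add: borel_prob_measures_def)
  obtain N where N: "\<And>n \<sigma> x y. N \<le> n \<Longrightarrow> dist (word_map w \<sigma> n x) (word_map w \<sigma> n y) < r / 2"
    using uniform_contraction[of "r / 2"] r by auto
  show "\<exists>N. \<forall>n\<ge>N. norm (hutchinson_dist ((transfer_op w p ^^ n) \<mu>) stationary - 0) < r"
  proof (intro exI allI impI)
    fix n assume "N \<le> n"
    have close: "\<bar>(\<integral>x. f x \<partial>(transfer_op w p ^^ n) \<mu>) - (\<integral>x. f x \<partial>stationary)\<bar> \<le> r / 2"
      if f: "\<And>x y. \<bar>f x - f y\<bar> \<le> dist x y" for f :: "'x \<Rightarrow> real"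
    proof -
      note [measurable] = Lipschitz_measurable_bounded(1)[OF f]
      have bound: "\<bar>f x\<bar> \<le> \<bar>f undefined\<bar> + diameter (UNIV :: 'x set)" for x
        using Lipschitz_measurable_bounded(2)[OF f, of x undefined] by linarith
      have "\<bar>f (word_map w \<sigma> n x) - f (word_map w \<sigma> n y)\<bar> \<le> r / 2" for \<sigma> x y
        using f[of "word_map w \<sigma> n x" "word_map w \<sigma> n y"] N[OF \<open>N \<le> n\<close>, of \<sigma> x y] by linarith
      then have "\<bar>(trans_op ^^ n) f x - (\<integral>x. f x \<partial>stationary)\<bar> \<le> r / 2" for x
        by (intro trans_op_funpow_close[OF _ bound]) simp_all
      moreover have "(trans_op ^^ n) f \<in> borel_measurable \<mu>"
        using trans_op_funpow_measurable[of f n] by (simp add: measurable_cong_sets[OF sets_mu refl])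
      ultimately have "\<bar>(\<integral>x. (trans_op ^^ n) f x \<partial>\<mu>) - (\<integral>x. f x \<partial>stationary)\<bar> \<le> r / 2"
        by (intro prob_space.expectation_close_to_const[OF prob]) auto
      then show ?thesis by (subst integral_transfer_op_funpow[OF mu _ bound]) simp_all
    qed
    have "hutchinson_dist ((transfer_op w p ^^ n) \<mu>) stationary \<le> r / 2"
      unfolding hutchinson_dist_def
    proof (rule cSUP_least)
      show "{f :: 'x \<Rightarrow> real. \<forall>x y. \<bar>f x - f y\<bar> \<le> dist x y} \<noteq> {}"
        by (auto intro!: exI[of _ "\<lambda>_. 0"])
    qed (use close in simp)
    moreover have "0 \<le> hutchinson_dist ((transfer_op w p ^^ n) \<mu>) stationary"
      using integral_diff_le_hutchinson_dist[OF transfer_op_funpow_prob[OF mu] stationary_prob, of "\<lambda>_. 0" n]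
      by simp
    ultimately show "norm (hutchinson_dist ((transfer_op w p ^^ n) \<mu>) stationary - 0) < r"
      using r by simp
  qed
qed

text \<open>
  The iterates of a single measure converge to both attractors, so the two give the same integral to every
  1-Lipschitz function.
\<close>

lemma measure_attractor_unique:
  assumes \<nu>: "is_measure_attractor w p \<nu>" and \<nu>': "is_measure_attractor w p \<nu>'"
  shows "\<nu> = \<nu>'"
proof (rule borel_prob_eq_if_Lipschitz_integrals_eq)
  show prob: "\<nu> \<in> borel_prob_measures" "\<nu>' \<in> borel_prob_measures"
    using assms by (simp_all add: is_measure_attractor_def)
  fix f :: "'x \<Rightarrow> real" assume f: "\<And>x y. \<bar>f x - f y\<bar> \<le> dist x y"
  have "(\<lambda>n. \<integral>x. f x \<partial>(transfer_op w p ^^ n) \<nu>) \<longlonglongrightarrow> (\<integral>x. f x \<partial>M)"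
    if "is_measure_attractor w p M" for M
  proof -
    have M: "M \<in> borel_prob_measures" and
      lim: "(\<lambda>n. hutchinson_dist ((transfer_op w p ^^ n) \<nu>) M) \<longlonglongrightarrow> 0"
      using that prob(1) by (simp_all add: is_measure_attractor_def)
    have "(\<lambda>n. (\<integral>x. f x \<partial>(transfer_op w p ^^ n) \<nu>) - (\<integral>x. f x \<partial>M)) \<longlonglongrightarrow> 0"
    proof (rule Lim_null_comparison[OF _ lim], intro always_eventually allI)
      fix n
      show "norm ((\<integral>x. f x \<partial>(transfer_op w p ^^ n) \<nu>) - (\<integral>x. f x \<partial>M))
          \<le> hutchinson_dist ((transfer_op w p ^^ n) \<nu>) M"
        using integral_diff_le_hutchinson_dist[OF transfer_op_funpow_prob[OF prob(1)] M f] by simp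
    qed
    then show ?thesis by (simp add: LIM_zero_iff)
  qed
  from this[OF \<nu>] this[OF \<nu>'] show "(\<integral>x. f x \<partial>\<nu>) = (\<integral>x. f x \<partial>\<nu>')"
    by (rule LIMSEQ_unique)
qed

section \<open>Averages along random orbits\<close>

text \<open>
  Given the first \<open>j\<close> letters, the next letter is still distributed according to \<open>p\<close>, so the conditional mean of
  \<open>f X\<^bsub>j+1\<^esub>\<close> is \<open>(trans_op f) X\<^sub>j\<close>. The increment at time \<open>j\<close> therefore has conditional
  mean \<open>0\<close> and is orthogonal to all earlier ones.
\<close>

lemma orbit_increment_averages:
  assumes f [measurable]: "f \<in> borel_measurable borel" and bound: "\<And>x. \<bar>f x\<bar> \<le> B"
  shows "AE \<sigma> in S. (\<lambda>n. (\<Sum>j<n. f (random_orbit w \<sigma> (Suc j) x)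
      - trans_op f (random_orbit w \<sigma> j x)) / real n) \<longlonglongrightarrow> 0"
proof (rule P.orthogonal_averages_tendsto_0)
  define D where "D j \<sigma> = f (random_orbit w \<sigma> (Suc j) x) - trans_op f (random_orbit w \<sigma> j x)" for j \<sigma>
  have D_meas [measurable]: "D j \<in> borel_measurable S" for j
    unfolding D_def[abs_def] by measurable
  have D_bound: "\<bar>D j \<sigma>\<bar> \<le> 2 * B" for j \<sigma>
    using bound[of "random_orbit w \<sigma> (Suc j) x"] trans_op_bounded[OF f bound, of "random_orbit w \<sigma> j x"]
    unfolding D_def by linarith
  show "(\<lambda>\<sigma>. f (random_orbit w \<sigma> (Suc j) x) - trans_op f (random_orbit w \<sigma> j x)) \<in> borel_measurable S" for j
    using D_meas[of j] by (simp add: D_def[abs_def])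
  show "\<bar>f (random_orbit w \<sigma> (Suc j) x) - trans_op f (random_orbit w \<sigma> j x)\<bar> \<le> 2 * B" for j \<sigma>
    using D_bound[of j \<sigma>] by (simp add: D_def)
  fix i j :: nat assume "i < j"
  \<comment> \<open>Conditioning on the first j letters: they are taken from \<open>\<sigma>\<close>, and all later ones from the independent word \<open>\<sigma>'\<close>.\<close>
  have Di: "D i (comb_seq j \<sigma> \<sigma>') = D i \<sigma>" for \<sigma> \<sigma>'
    using \<open>i < j\<close> by (simp only: D_def random_orbit_comb_seq less_imp_le Suc_leI)
  have Dj: "D j (comb_seq j \<sigma> \<sigma>')
      = f (w (\<sigma>' 0) (random_orbit w \<sigma> j x)) - trans_op f (random_orbit w \<sigma> j x)" for \<sigma> \<sigma>'
    using comb_seq_add[of j \<sigma> \<sigma>' 0] by (simp add: D_def random_orbit_comb_seq)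
  have fresh: "(\<integral>\<sigma>'. f (w (\<sigma>' 0) y) - trans_op f y \<partial>S) = 0" for y
  proof -
    have "(\<integral>\<sigma>'. f (w (\<sigma>' 0) y) \<partial>S) = (\<integral>l. f (w l y) \<partial>distr S p (\<lambda>\<sigma>. \<sigma> 0))"
      by (rule integral_distr[symmetric]) measurable
    also have "\<dots> = trans_op f y"
      using PiM_component[of 0] by (simp add: trans_op_def)
    moreover have "integrable S (\<lambda>\<sigma>'. f (w (\<sigma>' 0) y))"
      by (rule P.integrable_bounded_real[OF _ bound]) measurable
    ultimately show ?thesis using P.prob_space by simp
  qed
  have prod_bound: "\<bar>D i \<sigma> * D j \<sigma>\<bar> \<le> (2 * B) * (2 * B)" for \<sigma>
    unfolding abs_mult by (intro mult_mono D_bound) (use D_bound[of i \<sigma>] in auto)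
  have "(\<integral>\<sigma>. D i \<sigma> * D j \<sigma> \<partial>S)
      = (\<integral>\<sigma>. D i \<sigma> * D j \<sigma> \<partial>distr (S \<Otimes>\<^sub>M S) S (\<lambda>(\<sigma>, \<sigma>'). comb_seq j \<sigma> \<sigma>'))"
    unfolding PiM_comb_seq ..
  also have "\<dots> = (\<integral>z. D i (comb_seq j (fst z) (snd z)) * D j (comb_seq j (fst z) (snd z)) \<partial>(S \<Otimes>\<^sub>M S))"
    by (subst integral_distr) (measurable, simp add: split_beta)
  also have "\<dots> = (\<integral>\<sigma>. \<integral>\<sigma>'. D i (comb_seq j \<sigma> \<sigma>') * D j (comb_seq j \<sigma> \<sigma>') \<partial>S \<partial>S)"
    using bounded_iterated_integrals(1)[OF P.prob_space_axioms P.prob_space_axioms,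
        of "\<lambda>z. D i (comb_seq j (fst z) (snd z)) * D j (comb_seq j (fst z) (snd z))" "(2 * B) * (2 * B)"]
      prod_bound by simp
  also have "\<dots> = 0" by (simp only: Di Dj integral_mult_right_zero fresh) simp
  finally show "(\<integral>\<sigma>. (f (random_orbit w \<sigma> (Suc i) x) - trans_op f (random_orbit w \<sigma> i x)) *
      (f (random_orbit w \<sigma> (Suc j) x) - trans_op f (random_orbit w \<sigma> j x)) \<partial>S) = 0"
    by (simp only: D_def)
qed

proposition random_orbit_averages:
  fixes f :: "'x \<Rightarrow> real"
  assumes f: "continuous_on UNIV f"
  shows "AE \<sigma> in S. (\<lambda>n. (\<Sum>j=0..n. f (random_orbit w \<sigma> j x)) / real n)
      \<longlonglongrightarrow> (\<integral>y. f y \<partial>stationary)"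
proof -
  have meas: "f \<in> borel_measurable borel" using f by (rule borel_measurable_continuous_onI)
  obtain B where bound: "\<And>x. \<bar>f x\<bar> \<le> B"
    using compact_imp_bounded[OF compact_continuous_image[OF f compact_X]]
    by (auto simp: bounded_iff)
  have "AE \<sigma> in S. \<forall>k. (\<lambda>n. (\<Sum>j<n. (trans_op ^^ k) f (random_orbit w \<sigma> (Suc j) x)
      - (trans_op ^^ Suc k) f (random_orbit w \<sigma> j x)) / real n) \<longlonglongrightarrow> 0"
    unfolding AE_all_countable funpow.simps o_apply
    by (intro allI orbit_increment_averages[where B = B] trans_op_funpow_measurable[OF meas]
        trans_op_funpow_bounded[OF meas bound])
  then show ?thesis
  proof eventually_elim
    case (elim \<sigma>)
    have "(\<lambda>n. (\<Sum>j=0..n. (trans_op ^^ 0) f (random_orbit w \<sigma> j x)) / real n)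
        \<longlonglongrightarrow> (\<integral>y. f y \<partial>stationary)"
    proof (rule telescoping_averages_limit)
      show "\<bar>(trans_op ^^ k) f (random_orbit w \<sigma> j x)\<bar> \<le> B" for k j
        by (rule trans_op_funpow_bounded[OF meas bound])
      show "(\<lambda>n. (\<Sum>j<n. (trans_op ^^ k) f (random_orbit w \<sigma> (Suc j) x)
          - (trans_op ^^ Suc k) f (random_orbit w \<sigma> j x)) / real n) \<longlonglongrightarrow> 0" for k
        using elim by blast
      fix e :: real assume e: "0 < e"
      \<comment> \<open>For K large the images of all words of length K are so small that f oscillates by less than e on them.\<close>
      obtain d where d: "0 < d" "\<And>x y. dist x y < d \<Longrightarrow> dist (f x) (f y) < e"
        using compact_uniformly_continuous[OF f compact_X] e
        unfolding uniformly_continuous_on_def by auto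
      obtain K where K: "\<And>n \<sigma> x y. K \<le> n \<Longrightarrow> dist (word_map w \<sigma> n x) (word_map w \<sigma> n y) < d"
        using uniform_contraction[OF d(1)] by auto
      have "\<bar>(trans_op ^^ K) f y - (\<integral>y. f y \<partial>stationary)\<bar> \<le> e" for y
        using d(2)[OF K[OF order_refl]]
        by (intro trans_op_funpow_close[OF meas bound]) (simp add: dist_real_def less_imp_le)
      then show "\<exists>K. \<forall>j. \<bar>(trans_op ^^ K) f (random_orbit w \<sigma> j x) - (\<integral>y. f y \<partial>stationary)\<bar> \<le> e"
        by blast
    qed
    then show ?case by simp
  qed
qed

end

theorem theorem3:
  fixes w :: "'l::metric_space \<Rightarrow> 'x::metric_space \<Rightarrow> 'x"
    and p :: "'l measure"
  assumes "compact (UNIV :: 'x set)"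
    and "compact (UNIV :: 'l set)"
    and "continuous_on UNIV (\<lambda>(l, x). w l x)"
    and "weakly_hyperbolic w"
    and "p \<in> borel_prob_measures"
  shows "(\<exists>!\<nu>. is_measure_attractor w p \<nu>) \<and>
    (\<forall>\<nu>. is_measure_attractor w p \<nu> \<longrightarrow>
      (\<forall>(f :: 'x \<Rightarrow> real) x. continuous_on UNIV f \<longrightarrow>
        (AE \<sigma> in (\<Pi>\<^sub>M i\<in>(UNIV :: nat set). p).
          (\<lambda>n. 1 / real n * (\<Sum>j=0..n. f (random_orbit w \<sigma> j x)))
            \<longlonglongrightarrow> (\<integral>y. f y \<partial>\<nu>))))"
proof -
  interpret weakly_hyperbolic_ifs w p
    using assms by unfold_locales
  show ?thesis
  proof (intro conjI allI impI)
    show "\<exists>!\<nu>. is_measure_attractor w p \<nu>"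
      using stationary_is_attractor measure_attractor_unique by blast
  next
    fix \<nu> and f :: "'x \<Rightarrow> real" and x
    assume "is_measure_attractor w p \<nu>" and f: "continuous_on UNIV f"
    then have "\<nu> = stationary"
      using stationary_is_attractor by (intro measure_attractor_unique)
    with random_orbit_averages[OF f, of x]
    show "AE \<sigma> in S. (\<lambda>n. 1 / real n * (\<Sum>j=0..n. f (random_orbit w \<sigma> j x)))
        \<longlonglongrightarrow> (\<integral>y. f y \<partial>\<nu>)"
      by simp
  qed
qed

end
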